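(* Let $F$ be an Archimedean vector lattice and let $E$ be an order dense and majorizing sublattice of $F$. Let $H\subset F$ be an ideal such that $E\cap H$ is a projection band in $E$. Then $H$ is a projection band in $F$.
   Context: A sublattice of a vector lattice is a linear subspace closed under the lattice operations. An ideal of a vector lattice $F$ is a linear subspace $J\subset F$ such that $|f|\le|e|$, $e\in J$, $f\in F$ imply $f\in J$. A sublattice $E\subset F$ is order dense if for every $0<f\in F$ there is $e\in E$ with $0<e\le f$; it is majorizing if the smallest ideal of $F$ containing $E$ is $F$. An ideal $H$ in a vector lattice $F$ is a projection band in $F$ if $F=H+H^d$, where $H^d=\{f\in F:|f|\wedge|h|=0\text{ for all }h\in H\}$ (for a projection band in $E$, all of this is understood in the vector lattice $E$). *)

theory Defs
  imports Complex_Main "HOL-Library.Lattice_Algebras" "HOL-Library.Set_Algebras"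
begin

class vector_lattice = ordered_real_vector + lattice_ab_group_add_abs

class archimedean_vector_lattice = vector_lattice +
  assumes archimedean: "0 \<le> x \<Longrightarrow> (\<And>n::nat. real n *\<^sub>R x \<le> y) \<Longrightarrow> x = 0"

instance real :: archimedean_vector_lattice
proof
  fix x y :: real
  assume "0 \<le> x" and le: "\<And>n::nat. real n *\<^sub>R x \<le> y"
  show "x = 0"
  proof (rule ccontr)
    assume "x \<noteq> 0"
    with \<open>0 \<le> x\<close> have "0 < x" by simp
    then obtain n :: nat where "y < real n * x"
      using reals_Archimedean3 by blast
    with le[of n] show False by simp
  qed
qed

definition sublattice :: "'a::vector_lattice set \<Rightarrow> bool" where
  "sublattice E \<longleftrightarrow> subspace E \<and> (\<forall>x\<in>E. \<forall>y\<in>E. inf x y \<in> E \<and> sup x y \<in> E)"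

text \<open>
  The argument \<open>G\<close> of the next three notions is the ambient vector lattice, given as a
  sublattice of the type; taking \<open>G = UNIV\<close> gives the notions for the whole type.
  Since a sublattice is closed under \<open>inf\<close>, \<open>sup\<close> and negation, the moduli and infima
  computed in \<open>G\<close> are those of the type.
\<close>

definition ideal_in :: "'a::vector_lattice set \<Rightarrow> 'a set \<Rightarrow> bool" where
  "ideal_in G J \<longleftrightarrow> subspace J \<and> J \<subseteq> G \<and> (\<forall>e\<in>J. \<forall>f\<in>G. \<bar>f\<bar> \<le> \<bar>e\<bar> \<longrightarrow> f \<in> J)"

definition disjoint_complement_in :: "'a::vector_lattice set \<Rightarrow> 'a set \<Rightarrow> 'a set" where
  "disjoint_complement_in G H = {f \<in> G. \<forall>h\<in>H. inf \<bar>f\<bar> \<bar>h\<bar> = 0}"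

definition projection_band_in :: "'a::vector_lattice set \<Rightarrow> 'a set \<Rightarrow> bool" where
  "projection_band_in G H \<longleftrightarrow> ideal_in G H \<and> G = H + disjoint_complement_in G H"

definition order_dense :: "'a::vector_lattice set \<Rightarrow> bool" where
  "order_dense E \<longleftrightarrow> (\<forall>f>0. \<exists>e\<in>E. 0 < e \<and> e \<le> f)"

definition majorizing :: "'a::vector_lattice set \<Rightarrow> bool" where
  "majorizing E \<longleftrightarrow> ideal_in UNIV hull E = UNIV"

end

theory Submission
  imports Defs
begin

text \<open>
  Let \<open>f\<close> be any vector. As \<open>E\<close> is majorizing, \<open>\<bar>f\<bar>\<close> lies below some \<open>e \<in> E\<close>, and \<open>e\<close> splits
  as \<open>e\<^sub>1 + e\<^sub>2\<close> along the projection band \<open>E \<inter> H\<close> of \<open>E\<close>. Hence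
  \<open>\<bar>f\<bar> \<le> \<bar>e\<^sub>1\<bar> + \<bar>e\<^sub>2\<bar>\<close>, and the Riesz decomposition property (lemma \<open>riesz_decomposition\<close>)
  gives \<open>f = f\<^sub>1 + f\<^sub>2\<close> with \<open>\<bar>f\<^sub>1\<bar> \<le> \<bar>e\<^sub>1\<bar>\<close> and \<open>\<bar>f\<^sub>2\<bar> \<le> \<bar>e\<^sub>2\<bar>\<close>. The first part is in the ideal
  \<open>H\<close>, since \<open>e\<^sub>1\<close> is. The second is disjoint from \<open>H\<close> by order density: \<open>e\<^sub>2\<close> is known to be
  disjoint only from \<open>E \<inter> H\<close>, but any nonzero overlap with \<open>H\<close> would dominate a nonzero
  positive element of \<open>E\<close>, which would then lie in \<open>E \<inter> H\<close> and below \<open>\<bar>e\<^sub>2\<bar>\<close>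
  (lemma \<open>disjoint_from_ideal_if_disjoint_from_trace\<close>).
\<close>

lemma abs_scaleR_le:
  fixes x :: "'a::vector_lattice"
  shows "\<bar>c *\<^sub>R x\<bar> \<le> \<bar>c\<bar> *\<^sub>R \<bar>x\<bar>"
proof (cases "0 \<le> c")
  case True
  then have "c *\<^sub>R x \<le> c *\<^sub>R \<bar>x\<bar>" "c *\<^sub>R (- x) \<le> c *\<^sub>R \<bar>x\<bar>"
    by (intro scaleR_left_mono abs_ge_self abs_ge_minus_self; simp)+
  with True show ?thesis by (intro abs_leI) auto
next
  case False
  then have "(- c) *\<^sub>R x \<le> (- c) *\<^sub>R \<bar>x\<bar>" "(- c) *\<^sub>R (- x) \<le> (- c) *\<^sub>R \<bar>x\<bar>"
    by (intro scaleR_left_mono abs_ge_self abs_ge_minus_self; simp)+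
  with False show ?thesis by (intro abs_leI) auto
qed

lemma sublattice_abs_closed:
  assumes "sublattice E" "x \<in> E"
  shows "\<bar>x\<bar> \<in> E"
  using assms by (auto simp: sublattice_def abs_lattice subspace_neg)

text \<open>The vectors dominated in modulus by an element of \<open>E\<close> already form the ideal
  generated by \<open>E\<close>.\<close>

lemma majorizing_imp_dominated:
  assumes E: "sublattice E" and "majorizing E"
  shows "\<exists>e\<in>E. \<bar>f\<bar> \<le> e"
proof -
  let ?J = "{x. \<exists>e\<in>E. \<bar>x\<bar> \<le> e}"
  have sub: "subspace E"
    using E by (simp add: sublattice_def)
  have "subspace ?J"
  proof (rule subspaceI)
    show "0 \<in> ?J"
      using subspace_0[OF sub] by auto
  next
    fix x y assume "x \<in> ?J" "y \<in> ?J"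
    then obtain d e where "d \<in> E" "e \<in> E" "\<bar>x\<bar> \<le> d" "\<bar>y\<bar> \<le> e" by blast
    then have "d + e \<in> E" "\<bar>x + y\<bar> \<le> d + e"
      using subspace_add[OF sub] abs_triangle_ineq[of x y]
      by (auto intro: order_trans add_mono)
    then show "x + y \<in> ?J" by blast
  next
    fix c x assume "x \<in> ?J"
    then obtain e where "e \<in> E" "\<bar>x\<bar> \<le> e" by blast
    then have "\<bar>c\<bar> *\<^sub>R e \<in> E" "\<bar>c *\<^sub>R x\<bar> \<le> \<bar>c\<bar> *\<^sub>R e"
      using subspace_scale[OF sub] order_trans[OF abs_scaleR_le scaleR_left_mono]
      by auto
    then show "c *\<^sub>R x \<in> ?J" by blast
  qed
  then have "ideal_in UNIV ?J"
    by (auto simp: ideal_in_def intro: order_trans)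
  moreover have "E \<subseteq> ?J"
    using sublattice_abs_closed[OF E] by blast
  ultimately have "ideal_in UNIV hull E \<subseteq> ?J"
    by (simp add: hull_minimal)
  then show ?thesis
    using assms(2) by (auto simp: majorizing_def)
qed

text \<open>This form of the Riesz decomposition property is for vectors of arbitrary sign. The first
  component is \<open>f\<close> truncated to the order interval from \<open>- a\<close> to \<open>a\<close>, so that the remainder is
  only what \<open>f\<close> exceeds that interval by, and this is controlled by \<open>b\<close>.\<close>

lemma riesz_decomposition:
  fixes f a b :: "'a::lattice_ab_group_add_abs"
  assumes "0 \<le> a" "0 \<le> b" "\<bar>f\<bar> \<le> a + b"
  obtains f1 f2 where "f = f1 + f2" "\<bar>f1\<bar> \<le> a" "\<bar>f2\<bar> \<le> b"
proof
  let ?f1 = "sup (inf f a) (- a)"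
  have le: "f \<le> a + b" and ge: "- f \<le> a + b"
    using assms(3) abs_ge_self[of f] abs_ge_minus_self[of f] order_trans by blast+
  have "- a \<le> a"
    using assms(1) by (meson neg_le_0_iff_le order_trans)
  then have upper: "?f1 \<le> a" by simp
  have "- ?f1 \<le> a" by (simp add: minus_le_iff)
  with upper show "\<bar>?f1\<bar> \<le> a" by (rule abs_leI)
  have "f - b \<le> inf f a"
    using le assms(2) by (simp add: algebra_simps)
  also have "\<dots> \<le> ?f1" by simp
  finally have "f - ?f1 \<le> b" by (metis diff_le_eq add.commute)
  moreover have "?f1 \<le> f + b"
  proof (rule sup_least)
    show "inf f a \<le> f + b"
      using assms(2) by (simp add: le_infI1)
    show "- a \<le> f + b"
      using add_left_mono[OF ge, of "f - a"] by (simp add: algebra_simps)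
  qed
  then have "- (f - ?f1) \<le> b" by (simp add: algebra_simps)
  ultimately show "\<bar>f - ?f1\<bar> \<le> b" by (rule abs_leI)
  show "f = ?f1 + (f - ?f1)" by (simp only: add.commute[of ?f1] diff_add_cancel)
qed

text \<open>The overlap of \<open>f\<close> with an element of \<open>H\<close> is positive and lies below both; if it were
  nonzero, an element of \<open>E\<close> could be fitted below it, and this element would witness that \<open>g\<close> is
  not disjoint from \<open>E \<inter> H\<close>.\<close>

lemma disjoint_from_ideal_if_disjoint_from_trace:
  assumes "order_dense E" and H: "ideal_in UNIV H"
    and g: "g \<in> disjoint_complement_in G (E \<inter> H)"
    and "\<bar>f\<bar> \<le> \<bar>g\<bar>"
  shows "f \<in> disjoint_complement_in UNIV H"
  unfolding disjoint_complement_in_def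
proof (clarsimp, rule ccontr)
  fix h assume "h \<in> H" "inf \<bar>f\<bar> \<bar>h\<bar> \<noteq> 0"
  then have "0 < inf \<bar>f\<bar> \<bar>h\<bar>"
    by (simp add: order_less_le)
  then obtain e where e: "e \<in> E" "0 < e" "e \<le> inf \<bar>f\<bar> \<bar>h\<bar>"
    using assms(1) by (auto simp: order_dense_def)
  then have abs_e: "\<bar>e\<bar> = e" by simp
  have "e \<in> H"
    using H \<open>h \<in> H\<close> e abs_e by (auto simp: ideal_in_def)
  with g e(1) have "inf \<bar>g\<bar> \<bar>e\<bar> = 0"
    by (simp add: disjoint_complement_in_def)
  then have "inf \<bar>g\<bar> e = 0" by (simp only: abs_e)
  moreover have "e \<le> \<bar>g\<bar>"
    using e(3) assms(4) by (auto intro: order_trans)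
  ultimately show False
    using e(2) by (simp add: inf_absorb2)
qed

theorem corollary3p2:
  fixes E H :: "'a::archimedean_vector_lattice set"
  assumes "sublattice E"
    and "order_dense E"
    and "majorizing E"
    and "ideal_in UNIV H"
    and "projection_band_in E (E \<inter> H)"
  shows "projection_band_in UNIV H"
proof -
  have "f \<in> H + disjoint_complement_in UNIV H" for f
  proof -
    obtain e where "e \<in> E" "\<bar>f\<bar> \<le> e"
      using majorizing_imp_dominated assms(1,3) by blast
    moreover from \<open>e \<in> E\<close> obtain e1 e2 where e1: "e1 \<in> E \<inter> H"
      and e2: "e2 \<in> disjoint_complement_in E (E \<inter> H)" and "e = e1 + e2"
      using assms(5) unfolding projection_band_in_def by (metis set_plus_elim)
    ultimately have "\<bar>f\<bar> \<le> \<bar>e1\<bar> + \<bar>e2\<bar>"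
      using add_mono[OF abs_ge_self[of e1] abs_ge_self[of e2]] by (auto intro: order_trans)
    then obtain f1 f2 where f: "f = f1 + f2" "\<bar>f1\<bar> \<le> \<bar>e1\<bar>" "\<bar>f2\<bar> \<le> \<bar>e2\<bar>"
      by (rule riesz_decomposition[OF abs_ge_zero abs_ge_zero])
    have "f1 \<in> H"
      using assms(4) e1 f(2) by (auto simp: ideal_in_def)
    moreover have "f2 \<in> disjoint_complement_in UNIV H"
      using disjoint_from_ideal_if_disjoint_from_trace[OF assms(2,4) e2 f(3)] .
    ultimately show ?thesis
      using f(1) by (auto intro: set_plus_intro)
  qed
  then show ?thesis
    using assms(4) by (auto simp: projection_band_in_def)
qed

end
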